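(* Let $\rho^{\angle}_3(N)$ denote the largest density $|A|/N^2$ of a corner-free subset $A \subseteq [N]\times[N]$. Then, as $N\to\infty$, $$\rho^{\angle}_3(N) \ge 2^{-2\sqrt{\log e}\sqrt{\log N}+o(\sqrt{\log N})}.$$ Moreover, there is an explicit corner-free subset of $[N]\times[N]$ of size $N^2/2^{2\sqrt{\log e}\sqrt{\log N}+o(\sqrt{\log N})}$.
   Context: $[N]=\{1,\ldots,N\}$. A corner in $[N]\times[N]$ is a triple of points $(x,y),(x+\delta,y),(x,y+\delta)$ with $\delta\neq 0$ an integer; a set is corner-free if it contains no corner. All logarithms are base $2$, and asymptotic notation refers to $N\to\infty$. *)

theory Defs
  imports Complex_Main "HOL-Library.Landau_Symbols"
begin

definition grid :: "nat \<Rightarrow> (int \<times> int) set" where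
  "grid N = {1..int N} \<times> {1..int N}"

definition corner_free :: "(int \<times> int) set \<Rightarrow> bool" where
  "corner_free A \<longleftrightarrow>
     \<not> (\<exists>x y \<delta>. \<delta> \<noteq> 0 \<and> (x, y) \<in> A \<and> (x + \<delta>, y) \<in> A \<and> (x, y + \<delta>) \<in> A)"

definition corner_density :: "nat \<Rightarrow> real" where
  "corner_density N =
     Max {real (card A) / real N ^ 2 | A. A \<subseteq> grid N \<and> corner_free A}"

text \<open>
  An explicit family of corner-free sets. Let \<open>q = 2 * p\<close>. The lowest \<open>d\<close> base-\<open>q\<close> digits of
  \<open>x\<close> and \<open>y\<close> are constrained so that every digit sum lies in a window of length \<open>q\<close>; hence
  \<open>x + y\<close> determines the vector of digit sums as well as the sum of the remaining high parts.
  The difference of the high parts is required to be the squared Euclidean distance of the two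
  digit vectors, so that a corner with displacement vector \<open>w\<close> gives, by the parallelogram
  law, \<open>w = 0\<close>. No radius has to be selected by a pigeonhole argument.
\<close>

definition digit :: "nat \<Rightarrow> nat \<Rightarrow> int \<Rightarrow> int" where
  "digit q i x = (x div int q ^ i) mod int q"

definition digit_corner_set :: "nat \<Rightarrow> nat \<Rightarrow> nat \<Rightarrow> (int \<times> int) set" where
  "digit_corner_set p d N =
     {(x, y) \<in> grid N.
        (\<forall>i<d. int p \<le> digit (2 * p) i x + digit (2 * p) i y \<and>
               digit (2 * p) i x + digit (2 * p) i y < 3 * int p) \<and>
        x div int (2 * p) ^ d - y div int (2 * p) ^ d =
          (\<Sum>i<d. (digit (2 * p) i x - digit (2 * p) i y) ^ 2)}"

text \<open>
  Exactly \<open>3 * p\<^sup>2\<close> of the \<open>(2 * p)\<^sup>2\<close> pairs of digits are admissible. With \<open>d\<close> close to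
  \<open>c * sqrt (log 2 N)\<close> and \<open>2 * p\<close> close to \<open>N powr (1 / (d + 2))\<close>, the density is therefore
  \<open>2 powr (- (c * log 2 (4/3) + 2 / c) * sqrt (log 2 N))\<close> up to lower order terms in the
  exponent; the constant \<open>c\<close> below is a root of
  \<open>c * log 2 (4/3) + 2 / c = 2 * sqrt (log 2 e)\<close>.
  The factor \<open>2 * d\<close> leaves enough room in the high parts for the squared distance, which
  is less than \<open>d * (2 * p)\<^sup>2\<close>.
\<close>

definition dim_const :: real where
  "dim_const =
     2 / (sqrt (log 2 (exp 1)) + sqrt (log 2 (exp 1) - 2 * log 2 (4 / 3)))"

definition num_digits :: "nat \<Rightarrow> nat" where
  "num_digits N = nat \<lfloor>dim_const * sqrt (log 2 (real N))\<rfloor>"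

definition half_base :: "nat \<Rightarrow> nat" where
  "half_base N =
     nat \<lfloor>(real N / (2 * real (num_digits N))) powr (1 / (real (num_digits N) + 2)) / 2\<rfloor>"

definition explicit_set :: "nat \<Rightarrow> (int \<times> int) set" where
  "explicit_set N = digit_corner_set (half_base N) (num_digits N) N"

end

theory Submission
  imports Defs "HOL-Real_Asymp.Real_Asymp"
begin

text \<open>
  In a corner, the points \<open>(x + \<delta>, y)\<close> and \<open>(x, y + \<delta>)\<close> have the same coordinate sum, and the
  digit windows make that sum determine all digit sums and the sum of the high parts. Hence both
  coordinates are displaced by the same digit vector \<open>w\<close> and the same high part. Adding the
  conditions at these two points and applying the parallelogram law gives \<open>w = 0\<close>, so \<open>\<delta> = 0\<close>.

  For the size, put \<open>q = 2 * p\<close> and sort the points by their residues modulo \<open>q ^ d\<close>. There are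
  \<open>(3 * p\<^sup>2) ^ d\<close> admissible pairs of residues, and over each of them the difference of the high parts
  is fixed, so between \<open>N / (2 * q ^ d)\<close> and \<open>2 * N / q ^ d\<close> points remain. Since \<open>q ^ (d + 2)\<close> is
  about \<open>N / (2 * d)\<close>, the density is \<open>(3 / 4) ^ d / (2 * d * q\<^sup>2)\<close> up to a factor
  \<open>2 powr o(d)\<close>.
\<close>


section \<open>Base-\<open>q\<close> digits and corner-freeness\<close>

lemma div_power_Suc: "x div int q ^ Suc i = x div int q ^ i div int q"
  unfolding power_Suc2 by (rule zdiv_zmult2_eq) simp

lemma digit_bounds:
  assumes "q > 0"
  shows "0 \<le> digit q i x" "digit q i x < int q"
  using assms by (auto simp: digit_def)

lemma eq_if_digits_eq:
  assumes "\<And>i. i < d \<Longrightarrow> digit q i x = digit q i y"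
    and "x div int q ^ d = y div int q ^ d"
  shows "x = y"
  using assms
proof (induction d)
  case 0
  then show ?case by simp
next
  case (Suc d)
  have "x div int q ^ d mod int q = y div int q ^ d mod int q"
    using Suc.prems(1)[of d] by (simp add: digit_def)
  moreover have "x div int q ^ d div int q = y div int q ^ d div int q"
    using Suc.prems(2) by (simp only: div_power_Suc)
  ultimately have "x div int q ^ d = y div int q ^ d"
    by (metis mult_div_mod_eq)
  then show ?case using Suc by simp
qed

text \<open>A window of length \<open>q\<close> contains each residue modulo \<open>q\<close> at
  most once, so a digit sum can be read off from its residue even though the addition may carry.
  Induction on \<open>d\<close> recovers the digit sums from the lowest upwards; each one found also
  fixes the sum of the next quotients.\<close>

lemma add_digits_eq:
  fixes l :: int
  assumes sum: "x + y = x' + y'"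
    and win: "\<And>i. i < d \<Longrightarrow> digit q i x + digit q i y \<in> {l..<l + int q}"
    and win': "\<And>i. i < d \<Longrightarrow> digit q i x' + digit q i y' \<in> {l..<l + int q}"
  shows "(\<forall>i<d. digit q i x + digit q i y = digit q i x' + digit q i y') \<and>
    x div int q ^ d + y div int q ^ d = x' div int q ^ d + y' div int q ^ d"
  using win win'
proof (induction d)
  case 0
  then show ?case using sum by simp
next
  case (Suc d)
  define u v u' v' where uv: "u = x div int q ^ d" "v = y div int q ^ d"
    "u' = x' div int q ^ d" "v' = y' div int q ^ d"
  have IH: "\<forall>i<d. digit q i x + digit q i y = digit q i x' + digit q i y'"
    "u + v = u' + v'"
    unfolding uv using Suc.IH Suc.prems less_SucI by blast+
  have u: "u = int q * (u div int q) + u mod int q" "v = int q * (v div int q) + v mod int q"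
    "u' = int q * (u' div int q) + u' mod int q" "v' = int q * (v' div int q) + v' mod int q"
    by simp_all
  define k where "k = u' div int q + v' div int q - (u div int q + v div int q)"
  define s where "s = u mod int q + v mod int q"
  define s' where "s' = u' mod int q + v' mod int q"
  \<comment> \<open>As \<open>u + v = u' + v'\<close>, the two digit sums differ by a multiple of
    \<open>q\<close>; the common window of length \<open>q\<close> then forces that multiple to be
    0.\<close>
  have eq: "s - s' = int q * k"
    using IH(2) u unfolding k_def s_def s'_def right_diff_distrib distrib_left by linarith
  have "s \<in> {l..<l + int q}" "s' \<in> {l..<l + int q}"
    using Suc.prems(1)[of d] Suc.prems(2)[of d] unfolding s_def s'_def uv digit_def by auto
  then have "\<bar>s - s'\<bar> < int q" by auto
  then have "\<bar>int q * k\<bar> < int q" using eq by simp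
  then have "int q * \<bar>k\<bar> < int q * 1"
    by (simp add: abs_mult)
  then have "k = 0"
    unfolding mult_less_cancel_left by auto
  then have "s = s'" "u div int q + v div int q = u' div int q + v' div int q"
    using eq by (auto simp: k_def)
  then show ?case
    using IH(1) unfolding div_power_Suc uv s_def s'_def
    by (auto simp: less_Suc_eq digit_def)
qed

lemma digit_corner_set_subset_grid: "digit_corner_set p d N \<subseteq> grid N"
  by (auto simp: digit_corner_set_def)

lemma corner_free_digit_corner_set: "corner_free (digit_corner_set p d N)"
  unfolding corner_free_def
proof (intro notI, elim exE conjE)
  fix x y \<delta> :: int
  assume \<delta>: "\<delta> \<noteq> 0"
    and c0: "(x, y) \<in> digit_corner_set p d N"
    and c1: "(x + \<delta>, y) \<in> digit_corner_set p d N"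
    and c2: "(x, y + \<delta>) \<in> digit_corner_set p d N"
  let ?q = "2 * p"
  let ?D = "digit ?q"
  let ?h = "\<lambda>x. x div int ?q ^ d"
  have *: "(\<forall>i<d. ?D i (x + \<delta>) + ?D i y = ?D i x + ?D i (y + \<delta>)) \<and>
    ?h (x + \<delta>) + ?h y = ?h x + ?h (y + \<delta>)"
    using c1 c2 by (intro add_digits_eq[where l = "int p"]) (auto simp: digit_corner_set_def)
  define w where "w i = ?D i (x + \<delta>) - ?D i x" for i
  define a where "a i = ?D i x - ?D i y" for i
  have h0: "?h x - ?h y = (\<Sum>i<d. a i ^ 2)"
    using c0 by (auto simp: digit_corner_set_def a_def)
  have "?h (x + \<delta>) - ?h y = (\<Sum>i<d. (?D i (x + \<delta>) - ?D i y) ^ 2)"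
    using c1 by (auto simp: digit_corner_set_def)
  then have h1: "?h (x + \<delta>) - ?h y = (\<Sum>i<d. (a i + w i) ^ 2)"
    by (simp add: a_def w_def)
  have "?h x - ?h (y + \<delta>) = (\<Sum>i<d. (?D i x - ?D i (y + \<delta>)) ^ 2)"
    using c2 by (auto simp: digit_corner_set_def)
  \<comment> \<open>By \<open>*\<close>, moving from \<open>y\<close> to \<open>y + \<delta>\<close>
    changes digit \<open>i\<close> by the same \<open>w i\<close> as moving from \<open>x\<close> to
    \<open>x + \<delta>\<close>.\<close>
  also have "\<dots> = (\<Sum>i<d. (a i - w i) ^ 2)"
    by (rule sum.cong[OF refl], rule arg_cong[where f = "\<lambda>t. t ^ 2"])
      (use * in \<open>simp add: a_def w_def algebra_simps\<close>)
  finally have h2: "?h x - ?h (y + \<delta>) = (\<Sum>i<d. (a i - w i) ^ 2)" .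
  have "(\<Sum>i<d. (a i + w i) ^ 2) + (\<Sum>i<d. (a i - w i) ^ 2) = (\<Sum>i<d. 2 * (a i) ^ 2 + 2 * (w i) ^ 2)"
    by (simp add: sum.distrib[symmetric] power2_eq_square algebra_simps)
  also have "\<dots> = 2 * (\<Sum>i<d. (a i) ^ 2) + 2 * (\<Sum>i<d. (w i) ^ 2)"
    by (simp add: sum.distrib sum_distrib_left)
  \<comment> \<open>By \<open>*\<close>, the left sides of \<open>h1\<close> and \<open>h2\<close>
    add up to twice that of \<open>h0\<close>. Comparison with the parallelogram law leaves only the
    squares of the \<open>w i\<close>.\<close>
  finally have "(\<Sum>i<d. (w i) ^ 2) = 0"
    using h0 h1 h2 * by linarith
  then have w0: "w i = 0" if "i < d" for i
    using that by (simp add: sum_nonneg_eq_0_iff)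
  then have "?h (x + \<delta>) = ?h x"
    using h0 h1 by simp
  then have "x + \<delta> = x"
    using w0 by (intro eq_if_digits_eq[of d ?q "x + \<delta>" x]) (auto simp: w_def)
  then show False using \<delta> by simp
qed

section \<open>Counting the admissible residue pairs\<close>

text \<open>The residue pairs modulo \<open>(2 * p) ^ d\<close> to which the points of
  \<open>digit_corner_set p d N\<close> reduce. The digit condition depends only on these residues;
  the condition on the high parts is dealt with separately in each residue class.\<close>

definition window_pairs :: "nat \<Rightarrow> nat \<Rightarrow> (int \<times> int) set" where
  "window_pairs p d = {(a, b) \<in> {0..<int (2 * p) ^ d} \<times> {0..<int (2 * p) ^ d}.
     \<forall>i<d. digit (2 * p) i a + digit (2 * p) i b \<in> {int p..<3 * int p}}"

lemma finite_window_pairs: "finite (window_pairs p d)"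
  by (rule finite_subset[of _ "{0..<int (2 * p) ^ d} \<times> {0..<int (2 * p) ^ d}"])
    (auto simp: window_pairs_def)

lemma digit_mod_power:
  assumes "i < d" "q > 0"
  shows "digit q i (x mod int q ^ d) = digit q i x"
proof -
  obtain k where d: "d = Suc (i + k)" using assms(1) less_imp_Suc_add by blast
  define m where "m = x div int q ^ d"
  \<comment> \<open>Since \<open>i < d\<close>, the removed multiple of \<open>q ^ d\<close> has the
    factor \<open>q ^ i * q\<close>; division by \<open>q ^ i\<close> leaves a multiple of
    \<open>q\<close>, which digit \<open>i\<close> does not see.\<close>
  have "int q ^ i * (int q * (int q ^ k * m)) = int q ^ d * m"
    by (simp add: d power_add)
  then have "x = x mod int q ^ d + int q ^ i * (int q * (int q ^ k * m))"
    unfolding m_def using mod_mult_div_eq[of x "int q ^ d"] by linarith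
  then have "x div int q ^ i = x mod int q ^ d div int q ^ i + int q * (int q ^ k * m)"
    using assms(2) div_mult_self2[of "int q ^ i" "x mod int q ^ d" "int q * (int q ^ k * m)"] by simp
  then show ?thesis by (simp add: digit_def)
qed

text \<open>The rows \<open>s = j\<close> and \<open>s = j + p\<close> are glued together for each
  \<open>j < p\<close>. The first satisfies the upper bound automatically and its values
  \<open>s + t - p\<close> fill \<open>{0..<p + j}\<close>; the second satisfies the lower bound
  automatically and its values \<open>s + t\<close> fill \<open>{p + j..<3 * p}\<close>. Together
  they form a full interval of length \<open>3 * p\<close>.\<close>

lemma card_digit_window:
  "card {(s, t) \<in> {0..<int (2 * p)} \<times> {0..<int (2 * p)}. s + t \<in> {int p..<3 * int p}} = 3 * p ^ 2"
proof -
  let ?T = "{(s, t) \<in> {0..<int (2 * p)} \<times> {0..<int (2 * p)}. s + t \<in> {int p..<3 * int p}}"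
  let ?f = "\<lambda>(s, t). if s < int p then (s, s + t - int p) else (s - int p, s + t)"
  let ?g = "\<lambda>(j, r). if r < int p + j then (j, r + int p - j) else (j + int p, r - int p - j)"
  have "bij_betw ?f ?T ({0..<int p} \<times> {0..<3 * int p})"
    by (rule bij_betw_byWitness[where f' = ?g]) (auto split: if_splits)
  then have "card ?T = card ({0..<int p} \<times> {0..<3 * int p})"
    by (rule bij_betw_same_card)
  also have "\<dots> = 3 * p ^ 2"
    by (simp add: card_cartesian_product power2_eq_square nat_mult_distrib)
  finally show ?thesis .
qed

text \<open>The window conditions at different positions are independent, so splitting off the top
  digit of both coordinates contributes one factor \<open>card_digit_window\<close>.\<close>

lemma card_window_pairs: "card (window_pairs p d) = (3 * p ^ 2) ^ d"
proof (induction d)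
  case 0
  have "window_pairs p 0 = {(0, 0)}" by (auto simp: window_pairs_def)
  then show ?case by simp
next
  case (Suc d)
  show ?case
  proof (cases "p = 0")
    case True
    then have "window_pairs p (Suc d) = {}" by (auto simp: window_pairs_def)
    then show ?thesis using True by simp
  next
    case False
    let ?T = "{(s, t) \<in> {0..<int (2 * p)} \<times> {0..<int (2 * p)}. s + t \<in> {int p..<3 * int p}}"
    let ?q = "int (2 * p)"
    have q: "?q > 0" using False by simp
    have Q: "?q ^ d > 0" using q by simp
    \<comment> \<open>\<open>?f\<close> separates the lower \<open>d\<close> digits of both
      coordinates from their top digits, and \<open>?g\<close> reassembles them.\<close>
    let ?f = "\<lambda>z. ((fst z mod ?q ^ d, snd z mod ?q ^ d), (fst z div ?q ^ d, snd z div ?q ^ d))"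
    let ?g = "\<lambda>((a, b), (s, t)). (a + s * ?q ^ d, b + t * ?q ^ d)"
    have lt: "a + s * ?q ^ d < ?q ^ Suc d" if "a < ?q ^ d" "s < ?q" for a s
    proof -
      have "a + s * ?q ^ d < (s + 1) * ?q ^ d" using that by (simp add: algebra_simps)
      also have "\<dots> \<le> ?q * ?q ^ d" using that Q by (intro mult_right_mono) auto
      finally show ?thesis by simp
    qed
    \<comment> \<open>Below \<open>?q ^ Suc d\<close> the quotient is already less than
      \<open>?q\<close>, so the reduction in \<open>digit\<close> changes nothing.\<close>
    have top: "digit (2 * p) d x = x div ?q ^ d" if "0 \<le> x" "x < ?q ^ Suc d" for x
    proof -
      have "x div ?q ^ d < ?q"
      proof (rule ccontr)
        assume "\<not> ?thesis"
        then have "?q * ?q ^ d \<le> x div ?q ^ d * ?q ^ d"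
          using Q by (intro mult_right_mono) auto
        also have "\<dots> \<le> x"
          using Q div_mult_mod_eq[of x "?q ^ d"] pos_mod_sign[of "?q ^ d" x] by linarith
        finally show False using that by simp
      qed
      then show ?thesis using that Q by (simp add: digit_def pos_imp_zdiv_nonneg_iff del: of_nat_mult)
    qed
    have "bij_betw ?f (window_pairs p (Suc d)) (window_pairs p d \<times> ?T)"
    proof (rule bij_betw_byWitness[where f' = ?g])
      show "\<forall>z\<in>window_pairs p (Suc d). ?g (?f z) = z"
        by (simp add: mod_div_mult_eq split_beta del: of_nat_mult)
      show "\<forall>z\<in>window_pairs p d \<times> ?T. ?f (?g z) = z"
        using Q by (auto simp: window_pairs_def simp del: of_nat_mult)
      show "?f ` window_pairs p (Suc d) \<subseteq> window_pairs p d \<times> ?T"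
      proof (intro image_subsetI)
        fix z assume z: "z \<in> window_pairs p (Suc d)"
        obtain a b where ab: "z = (a, b)" by force
        have a: "0 \<le> a" "a < ?q ^ Suc d" "0 \<le> b" "b < ?q ^ Suc d"
          and w: "\<And>i. i < Suc d \<Longrightarrow> digit (2 * p) i a + digit (2 * p) i b \<in> {int p..<3 * int p}"
          using z by (auto simp: window_pairs_def ab simp del: of_nat_mult power_Suc)
        have "(a mod ?q ^ d, b mod ?q ^ d) \<in> window_pairs p d"
          using w Q False by (auto simp: window_pairs_def digit_mod_power simp del: of_nat_mult)
        moreover have "a div ?q ^ d + b div ?q ^ d \<in> {int p..<3 * int p}"
          using w[of d] top a by (metis lessI)
        moreover have "a div ?q ^ d \<in> {0..<?q}" "b div ?q ^ d \<in> {0..<?q}"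
          using top[of a] top[of b] a digit_bounds[of "2 * p" d] False
          by (metis atLeastLessThan_iff mult_pos_pos not_gr_zero zero_less_numeral)+
        ultimately show "?f z \<in> window_pairs p d \<times> ?T"
          by (simp add: ab del: of_nat_mult)
      qed
      show "?g ` (window_pairs p d \<times> ?T) \<subseteq> window_pairs p (Suc d)"
      proof (intro image_subsetI)
        fix z assume z: "z \<in> window_pairs p d \<times> ?T"
        obtain a b s t where ab: "z = ((a, b), (s, t))" by (metis surj_pair)
        have a: "0 \<le> a" "a < ?q ^ d" "0 \<le> b" "b < ?q ^ d" "0 \<le> s" "s < ?q" "0 \<le> t" "t < ?q"
          and st: "s + t \<in> {int p..<3 * int p}"
          and w: "\<And>i. i < d \<Longrightarrow> digit (2 * p) i a + digit (2 * p) i b \<in> {int p..<3 * int p}"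
          using z by (auto simp: window_pairs_def ab simp del: of_nat_mult)
        let ?x = "a + s * ?q ^ d" and ?y = "b + t * ?q ^ d"
        have xy: "0 \<le> ?x" "?x < ?q ^ Suc d" "0 \<le> ?y" "?y < ?q ^ Suc d"
          using a Q lt by auto
        have d: "digit (2 * p) d ?x = s" "digit (2 * p) d ?y = t"
          using top[of ?x] top[of ?y] xy a by auto
        have "digit (2 * p) i ?x = digit (2 * p) i a" "digit (2 * p) i ?y = digit (2 * p) i b" if "i < d" for i
          using that digit_mod_power[of i d "2 * p" ?x] digit_mod_power[of i d "2 * p" ?y] False a
          by (simp_all del: of_nat_mult)
        then have "\<forall>i<Suc d. digit (2 * p) i ?x + digit (2 * p) i ?y \<in> {int p..<3 * int p}"
          using w st d unfolding less_Suc_eq by metis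
        then show "?g z \<in> window_pairs p (Suc d)"
          using xy unfolding window_pairs_def ab by simp
      qed
    qed
    then have "card (window_pairs p (Suc d)) = card (window_pairs p d \<times> ?T)"
      by (rule bij_betw_same_card)
    also have "\<dots> = (3 * p ^ 2) ^ Suc d"
      unfolding card_cartesian_product card_digit_window Suc.IH by simp
    finally show ?thesis .
  qed
qed

section \<open>Size of the digit corner set\<close>

text \<open>Fixing the residues settles the digit condition and makes the squared distance a
  constant \<open>S\<close>. What remains free is the high part \<open>v\<close> of
  \<open>y\<close>, that of \<open>x\<close> being \<open>v + S\<close>. The hypothesis on
  \<open>N\<close> keeps \<open>S\<close> below half of \<open>N / q ^ d\<close>, so the shift by
  \<open>S\<close> costs at most a constant factor.\<close>

lemma card_digit_corner_set_fiber_bounds: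
  assumes p: "p > 0" and d: "d > 0" and N: "2 * d * (2 * p) ^ (d + 2) \<le> N"
    and ab: "(a, b) \<in> window_pairs p d"
  defines "F \<equiv> {z \<in> digit_corner_set p d N.
    (fst z mod int (2 * p) ^ d, snd z mod int (2 * p) ^ d) = (a, b)}"
  shows "real N / real (2 * p) ^ d / 2 \<le> real (card F)"
    and "real (card F) \<le> 2 * (real N / real (2 * p) ^ d)"
proof -
  define q where "q = 2 * p"
  define Q where "Q = int q ^ d"
  have q: "q \<ge> 2" using p by (simp add: q_def)
  then have Q: "Q > 0" by (simp add: Q_def)
  define S where "S = (\<Sum>i<d. (digit q i a - digit q i b) ^ 2)"
  have ab': "0 \<le> a" "a < Q" "0 \<le> b" "b < Q"
    "\<And>i. i < d \<Longrightarrow> int p \<le> digit q i a + digit q i b \<and> digit q i a + digit q i b < 3 * int p"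
    using ab unfolding window_pairs_def q_def Q_def by auto
  have F: "F = {(x, y) \<in> grid N. x mod Q = a \<and> y mod Q = b \<and> x div Q - y div Q = S}"
  proof -
    have *: "(\<forall>i<d. int p \<le> digit q i x + digit q i y \<and> digit q i x + digit q i y < 3 * int p) \<and>
      x div Q - y div Q = (\<Sum>i<d. (digit q i x - digit q i y) ^ 2) \<longleftrightarrow> x div Q - y div Q = S"
      if "x mod Q = a" "y mod Q = b" for x y
    proof -
      have eq: "digit q i x = digit q i a" "digit q i y = digit q i b" if "i < d" for i
        using digit_mod_power[of i d q x] digit_mod_power[of i d q y] q that
          \<open>x mod Q = a\<close> \<open>y mod Q = b\<close> by (simp_all add: Q_def)
      then have "(\<Sum>i<d. (digit q i x - digit q i y) ^ 2) = S"
        unfolding S_def by (intro sum.cong) simp_all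
      then show ?thesis using eq ab'(5) by simp
    qed
    show ?thesis
    proof (rule set_eqI)
      fix z :: "int \<times> int"
      obtain x y where z: "z = (x, y)" by force
      show "z \<in> F \<longleftrightarrow> z \<in> {(x, y) \<in> grid N. x mod Q = a \<and> y mod Q = b \<and> x div Q - y div Q = S}"
        unfolding F_def digit_corner_set_def q_def[symmetric] Q_def[symmetric] z
          mem_Collect_eq prod.case fst_conv snd_conv prod.inject
        using *[of x y] by blast
    qed
  qed
  have S0: "0 \<le> S" by (simp add: S_def sum_nonneg)
  \<comment> \<open>Using \<open>q - 1\<close> instead of \<open>q\<close> as the bound for a digit
    difference saves 3 in the bound for \<open>S\<close>; this slack pays for the boundary values of
    \<open>v\<close> left out in the lower bound.\<close>
  have "(digit q i a - digit q i b) ^ 2 \<le> (int q - 1) ^ 2" for i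
    using digit_bounds[of q i a] digit_bounds[of q i b] q
    by (intro abs_le_square_iff[THEN iffD1]) auto
  then have "S \<le> int d * (int q - 1) ^ 2"
    unfolding S_def using sum_bounded_above[of "{..<d}" _ "(int q - 1) ^ 2"] by simp
  also have "\<dots> = int d * int q ^ 2 - int d * (2 * int q - 1)"
    by (simp add: power2_eq_square algebra_simps)
  also have "\<dots> \<le> int d * int q ^ 2 - 1 * 3"
    using d q by (intro diff_mono mult_mono) auto
  finally have S: "S \<le> int d * int q ^ 2 - 3" by simp
  define n where "n = int N div Q"
  have "2 * int d * int q ^ 2 * Q \<le> int N"
  proof -
    have "int (2 * d * q ^ (d + 2)) \<le> int N" using N unfolding q_def by (simp only: of_nat_le_iff)
    then show ?thesis by (simp add: Q_def power_add mult_ac power2_eq_square)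
  qed
  then have "2 * int d * int q ^ 2 \<le> n"
    unfolding n_def using zdiv_mono1[OF _ Q] Q by fastforce
  then have nS: "2 * S + 6 \<le> n" using S by linarith
  have nQ: "n * Q \<le> int N" "int N < (n + 1) * Q"
  proof -
    have "n * Q + int N mod Q = int N" by (simp add: n_def)
    then show "n * Q \<le> int N" "int N < (n + 1) * Q"
      using pos_mod_bound[OF Q, of "int N"] pos_mod_sign[OF Q, of "int N"]
      by (simp_all add: distrib_right)
  qed
  have N_Q: "real_of_int n \<le> real N / real q ^ d" "real N / real q ^ d \<le> real_of_int n + 1"
  proof -
    have "real_of_int (n * Q) \<le> real_of_int (int N)" "real_of_int (int N) \<le> real_of_int ((n + 1) * Q)"
      using nQ by (simp_all only: of_int_le_iff)
    then show "real_of_int n \<le> real N / real q ^ d" "real N / real q ^ d \<le> real_of_int n + 1"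
      using q by (simp_all add: Q_def field_simps)
  qed
  have "finite (grid N)" by (simp add: grid_def)
  then have fin: "finite F" by (rule finite_subset[rotated]) (auto simp: F)

  \<comment> \<open>Starting at \<open>v = 1\<close> keeps both coordinates positive even if a
    residue is 0. Stopping at \<open>v + S = n - 1\<close> keeps them below \<open>n * Q\<close>,
    whatever the residues are.\<close>
  let ?f = "\<lambda>v. ((v + S) * Q + a, v * Q + b)"
  have "?f ` {1..n - 1 - S} \<subseteq> F"
  proof (intro image_subsetI)
    fix v assume v: "v \<in> {1..n - 1 - S}"
    have "(v + S) * Q + a < (v + S + 1) * Q" using ab' by (simp add: distrib_right)
    also have "\<dots> \<le> n * Q" using v Q by (intro mult_right_mono) auto
    finally have 1: "(v + S) * Q + a \<le> int N" using nQ by simp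
    have "v * Q + b < (v + 1) * Q" using ab' by (simp add: distrib_right)
    also have "\<dots> \<le> n * Q" using v Q S0 by (intro mult_right_mono) auto
    finally have 2: "v * Q + b \<le> int N" using nQ by simp
    have 3: "1 * 1 \<le> v * Q" "1 * 1 \<le> (v + S) * Q"
      using v Q S0 by (intro mult_mono; simp)+
    show "?f v \<in> F"
      using 1 2 3 ab' Q unfolding F grid_def by simp
  qed
  then have "card (?f ` {1..n - 1 - S}) \<le> card F"
    using fin by (rule card_mono[rotated])
  moreover have "card (?f ` {1..n - 1 - S}) = nat (n - 1 - S)"
    using Q by (subst card_image) (auto simp: inj_on_def)
  ultimately have "n - 1 - S \<le> int (card F)" by linarith
  then have "n + 1 \<le> 2 * int (card F)" using nS by linarith
  then have "real_of_int (n + 1) \<le> real_of_int (2 * int (card F))"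
    by (simp only: of_int_le_iff)
  then show "real N / real (2 * p) ^ d / 2 \<le> real (card F)"
    using N_Q unfolding q_def by simp

  \<comment> \<open>For the upper bound, the high part of \<open>y\<close> determines the point and
    lies in \<open>{0..n}\<close>; \<open>n + 1 \<le> 2 * n\<close> as \<open>n\<close> is at least
    6.\<close>
  have "inj_on (\<lambda>z. snd z div Q) F"
  proof (rule inj_onI)
    fix z z' assume z: "z \<in> F" "z' \<in> F" "snd z div Q = snd z' div Q"
    then have "snd z mod Q = snd z' mod Q" "fst z mod Q = fst z' mod Q" "fst z div Q = fst z' div Q"
      unfolding F by auto
    then have "snd z = snd z'" "fst z = fst z'"
      using z(3) by (metis mult_div_mod_eq)+
    then show "z = z'" by (simp add: prod_eq_iff)
  qed
  moreover have "(\<lambda>z. snd z div Q) ` F \<subseteq> {0..n}"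
    using Q by (auto simp: F grid_def n_def pos_imp_zdiv_nonneg_iff intro: zdiv_mono1)
  ultimately have "card F \<le> card {0..n}"
    by (intro card_inj_on_le) auto
  then have "int (card F) \<le> 2 * n" using nS S0 by simp
  then have "real_of_int (int (card F)) \<le> real_of_int (2 * n)"
    by (simp only: of_int_le_iff)
  then show "real (card F) \<le> 2 * (real N / real (2 * p) ^ d)"
    using N_Q unfolding q_def by simp
qed

text \<open>Sums the fibre bounds over all residue pairs. As \<open>3 * p ^ 2\<close> is 3/4 of
  \<open>(2 * p) ^ 2\<close>, the windows cost a factor \<open>(3 / 4) ^ d\<close>.\<close>

lemma card_digit_corner_set_bounds:
  assumes p: "p > 0" and d: "d > 0" and N: "2 * d * (2 * p) ^ (d + 2) \<le> N"
  shows "(3 / 4) ^ d * real (2 * p) ^ d * real N / 2 \<le> real (card (digit_corner_set p d N))"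
    and "real (card (digit_corner_set p d N)) \<le> 2 * ((3 / 4) ^ d * real (2 * p) ^ d * real N)"
proof -
  let ?E = "digit_corner_set p d N" and ?W = "window_pairs p d"
  let ?Q = "int (2 * p) ^ d"
  let ?\<pi> = "\<lambda>z. (fst z mod ?Q, snd z mod ?Q)"
  have "finite (grid N)" by (simp add: grid_def)
  then have fin: "finite ?E"
    using digit_corner_set_subset_grid by (rule finite_subset[rotated])
  have Q: "?Q > 0" using p by simp
  have "?\<pi> ` ?E \<subseteq> ?W"
    using Q p unfolding window_pairs_def digit_corner_set_def
    by (auto simp: digit_mod_power simp del: of_nat_mult)
  then have "(\<Sum>w\<in>?W. \<Sum>z\<in>{z \<in> ?E. ?\<pi> z = w}. 1) = (\<Sum>z\<in>?E. 1 :: nat)"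
    by (intro sum.group fin finite_window_pairs)
  then have card: "real (card ?E) = (\<Sum>w\<in>?W. real (card {z \<in> ?E. ?\<pi> z = w}))"
    by (simp del: of_nat_mult add: of_nat_sum[symmetric])
  have W: "real (card ?W) * (real N / real (2 * p) ^ d) = (3 / 4) ^ d * real (2 * p) ^ d * real N"
  proof -
    have "(3 * real p ^ 2) = (3 / 4) * real (2 * p) * real (2 * p)" by (simp add: power2_eq_square)
    then have "real (card ?W) = (3 / 4) ^ d * real (2 * p) ^ d * real (2 * p) ^ d"
      by (simp only: card_window_pairs of_nat_power of_nat_mult of_nat_numeral power_mult_distrib[symmetric])
    then show ?thesis using p by simp
  qed
  have "real (card ?W) * (real N / real (2 * p) ^ d / 2) \<le> real (card ?E)"
    unfolding card using card_digit_corner_set_fiber_bounds(1)[OF assms]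
    by (intro sum_bounded_below) (auto simp del: of_nat_mult)
  then show "(3 / 4) ^ d * real (2 * p) ^ d * real N / 2 \<le> real (card ?E)"
    unfolding W[symmetric] by (simp only: times_divide_eq_right)
  have "real (card ?E) \<le> real (card ?W) * (2 * (real N / real (2 * p) ^ d))"
    unfolding card using card_digit_corner_set_fiber_bounds(2)[OF assms]
    by (intro sum_bounded_above) (auto simp del: of_nat_mult)
  then show "real (card ?E) \<le> 2 * ((3 / 4) ^ d * real (2 * p) ^ d * real N)"
    unfolding W[symmetric] by (simp only: mult.left_commute)
qed

section \<open>Asymptotics of the dimension and the base\<close>

abbreviation (input) sqrt_log :: "nat \<Rightarrow> real" where
  "sqrt_log N \<equiv> sqrt (log 2 (real N))"

text \<open>The base before it is rounded down to an even integer: for positive \<open>N\<close> and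
  \<open>d = num_digits N\<close>, its power \<open>d + 2\<close> is exactly
  \<open>N / (2 * d)\<close>, the extreme case of the size hypothesis in the counting
  bounds.\<close>

definition real_base :: "nat \<Rightarrow> real" where
  "real_base N = (real N / (2 * real (num_digits N))) powr (1 / (real (num_digits N) + 2))"

lemma half_base_eq: "half_base N = nat \<lfloor>real_base N / 2\<rfloor>"
  by (simp add: half_base_def real_base_def)

text \<open>Since 16/9 is at most 2 and 2 is at most e, the radicand in \<open>dim_const\<close> is
  nonnegative.\<close>

lemma log_4_3_bound: "2 * log 2 (4 / 3) \<le> log 2 (exp 1)"
proof -
  have "2 * log 2 (4 / 3 :: real) = log 2 ((4 / 3) ^ 2)"
    by (subst log_nat_power) auto
  also have "\<dots> \<le> log 2 (exp 1)"
    using exp_ge_add_one_self[of "1 :: real"] by (subst log_le_cancel_iff) (auto simp: power2_eq_square)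
  finally show ?thesis .
qed

lemma dim_const_pos: "dim_const > 0"
proof -
  have "log 2 (exp 1) > (0 :: real)" by simp
  then have "sqrt (log 2 (exp 1)) > 0" by simp
  moreover have "sqrt (log 2 (exp 1) - 2 * log 2 (4 / 3)) \<ge> 0"
    using log_4_3_bound by simp
  ultimately show ?thesis
    unfolding dim_const_def by (intro divide_pos_pos add_pos_nonneg) simp_all
qed

text \<open>For the two square roots \<open>s\<close> and \<open>t\<close> in
  \<open>dim_const\<close>, the term \<open>2 / dim_const\<close> is \<open>s + t\<close>. Since
  \<open>2 * log 2 (4 / 3)\<close> is the difference of squares \<open>s ^ 2 - t ^ 2\<close>, the
  other term is \<open>s - t\<close>, and \<open>t\<close> cancels.\<close>

lemma dim_const_root:
  "dim_const * log 2 (4 / 3) + 2 / dim_const = 2 * sqrt (log 2 (exp 1))"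
proof -
  define s t where "s = sqrt (log 2 (exp 1))" and "t = sqrt (log 2 (exp 1) - 2 * log 2 (4 / 3))"
  have c: "dim_const = 2 / (s + t)" by (simp add: dim_const_def s_def t_def)
  have pos: "s + t > 0" using dim_const_pos unfolding c by (simp add: zero_less_divide_iff)
  have "s ^ 2 = log 2 (exp 1)" "t ^ 2 = log 2 (exp 1) - 2 * log 2 (4 / 3)"
    unfolding s_def t_def using log_4_3_bound by (simp_all add: real_sqrt_pow2)
  then have "2 * log 2 (4 / 3) = (s + t) * (s - t)"
    by (simp add: power2_eq_square algebra_simps)
  moreover have "dim_const * log 2 (4 / 3) = (2 * log 2 (4 / 3)) / (s + t)"
    by (simp add: c)
  ultimately have "dim_const * log 2 (4 / 3) = s - t" using pos by simp
  moreover have "2 / dim_const = s + t" by (simp add: c)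
  ultimately have "dim_const * log 2 (4 / 3) + 2 / dim_const = 2 * s" by linarith
  then show ?thesis unfolding s_def .
qed

lemma sqrt_log_at_top: "filterlim sqrt_log at_top sequentially"
  by real_asymp

lemma inverse_sqrt_log_tendsto: "(\<lambda>N. 1 / sqrt_log N) \<longlonglongrightarrow> 0"
  by real_asymp

lemma num_digits_bounds:
  assumes "N \<ge> 1"
  shows "dim_const * sqrt_log N - 1 \<le> real (num_digits N)" "real (num_digits N) \<le> dim_const * sqrt_log N"
proof -
  have "0 \<le> dim_const * sqrt_log N" using assms dim_const_pos by simp
  then show "dim_const * sqrt_log N - 1 \<le> real (num_digits N)" "real (num_digits N) \<le> dim_const * sqrt_log N"
    unfolding num_digits_def by linarith+
qed

lemma num_digits_asymp: "(\<lambda>N. real (num_digits N) / sqrt_log N) \<longlonglongrightarrow> dim_const"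
proof (rule tendsto_sandwich)
  have ev: "eventually (\<lambda>N. N \<ge> 1 \<and> sqrt_log N > 0) sequentially"
    by (intro eventually_conj eventually_ge_at_top eventually_compose_filterlim[OF eventually_gt_at_top sqrt_log_at_top])
  show "eventually (\<lambda>N. dim_const - 1 / sqrt_log N \<le> real (num_digits N) / sqrt_log N) sequentially"
    using ev
  proof eventually_elim
    case (elim N)
    then have "(dim_const * sqrt_log N - 1) / sqrt_log N \<le> real (num_digits N) / sqrt_log N"
      by (intro divide_right_mono num_digits_bounds) auto
    moreover have "sqrt_log N \<noteq> 0" using elim by linarith
    ultimately show ?case by (simp only: diff_divide_distrib nonzero_mult_div_cancel_right not_False_eq_True)
  qed
  show "eventually (\<lambda>N. real (num_digits N) / sqrt_log N \<le> dim_const) sequentially"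
    using ev
  proof eventually_elim
    case (elim N)
    then show ?case using num_digits_bounds(2)[of N] by (simp only: pos_divide_le_eq)
  qed
  show "(\<lambda>N. dim_const - 1 / sqrt_log N) \<longlonglongrightarrow> dim_const"
    using tendsto_diff[OF tendsto_const inverse_sqrt_log_tendsto, of dim_const] by simp
qed simp

lemma num_digits_at_top: "filterlim (\<lambda>N. real (num_digits N)) at_top sequentially"
proof (rule filterlim_at_top_mono)
  show "filterlim (\<lambda>N. dim_const * sqrt_log N - 1) at_top sequentially"
    using dim_const_pos by real_asymp
  show "eventually (\<lambda>N. dim_const * sqrt_log N - 1 \<le> real (num_digits N)) sequentially"
    using eventually_ge_at_top[of 1] by eventually_elim (rule num_digits_bounds(1))
qed

text \<open>The factor \<open>2 * d\<close> reserved in the base is thus invisible at the scale of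
  the exponent.\<close>

lemma log_num_digits_asymp: "(\<lambda>N. log 2 (2 * real (num_digits N)) / sqrt_log N) \<longlonglongrightarrow> 0"
proof -
  have "((\<lambda>x :: real. log 2 (2 * x) / x) \<longlongrightarrow> 0) at_top" by real_asymp
  then have "(\<lambda>N. log 2 (2 * real (num_digits N)) / real (num_digits N)) \<longlonglongrightarrow> 0"
    using num_digits_at_top by (rule filterlim_compose)
  from tendsto_mult[OF this num_digits_asymp]
  have "(\<lambda>N. log 2 (2 * real (num_digits N)) / real (num_digits N) *
    (real (num_digits N) / sqrt_log N)) \<longlonglongrightarrow> 0" by simp
  moreover have "eventually (\<lambda>N. log 2 (2 * real (num_digits N)) / real (num_digits N) *
    (real (num_digits N) / sqrt_log N) = log 2 (2 * real (num_digits N)) / sqrt_log N) sequentially"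
    using eventually_compose_filterlim[OF eventually_gt_at_top num_digits_at_top, of 0]
    by eventually_elim simp
  ultimately show ?thesis
    by (rule Lim_transform_eventually)
qed

lemma log_real_base:
  assumes "N > 0" "num_digits N > 0"
  shows "(real (num_digits N) + 2) * log 2 (real_base N) = log 2 (real N) - log 2 (2 * real (num_digits N))"
proof -
  have "log 2 (real_base N) = 1 / (real (num_digits N) + 2) * log 2 (real N / (2 * real (num_digits N)))"
    unfolding real_base_def using assms by (subst log_powr) auto
  also have "log 2 (real N / (2 * real (num_digits N))) = log 2 (real N) - log 2 (2 * real (num_digits N))"
    using assms by (subst log_divide) auto
  finally show ?thesis by simp
qed

lemma eventually_parameters_pos:
  "eventually (\<lambda>N. N > 0 \<and> num_digits N > 0 \<and> sqrt_log N > 0) sequentially"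
  using eventually_compose_filterlim[OF eventually_gt_at_top num_digits_at_top, of 0]
    eventually_compose_filterlim[OF eventually_gt_at_top sqrt_log_at_top, of 0]
    eventually_gt_at_top[of "0 :: nat"]
  by eventually_elim simp

lemma log_real_base_asymp: "(\<lambda>N. log 2 (real_base N) / sqrt_log N) \<longlonglongrightarrow> 1 / dim_const"
proof -
  let ?r = sqrt_log and ?d = "\<lambda>N. real (num_digits N)"
  \<comment> \<open>This is \<open>log_real_base\<close> divided by the square of
    \<open>?r N\<close> and solved for the wanted quotient; every ingredient has a known
    limit.\<close>
  have "(\<lambda>N. (1 - (log 2 (2 * ?d N) / ?r N) * (1 / ?r N)) / (?d N / ?r N + 2 * (1 / ?r N)))
    \<longlonglongrightarrow> (1 - 0 * 0) / (dim_const + 2 * 0)"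
    using dim_const_pos
    by (intro tendsto_intros num_digits_asymp log_num_digits_asymp inverse_sqrt_log_tendsto) simp
  moreover have "eventually (\<lambda>N. (1 - (log 2 (2 * ?d N) / ?r N) * (1 / ?r N)) / (?d N / ?r N + 2 * (1 / ?r N))
    = log 2 (real_base N) / ?r N) sequentially"
    using eventually_parameters_pos
  proof eventually_elim
    case (elim N)
    define r where "r = ?r N"
    have r: "r > 0" using elim by (simp add: r_def)
    have "log 2 (real N) = r ^ 2" using elim by (simp add: r_def real_sqrt_pow2)
    then have "(?d N + 2) * log 2 (real_base N) = r * r - log 2 (2 * ?d N)"
      using log_real_base[of N] elim by (simp add: power2_eq_square)
    then have "log 2 (real_base N) = (r * r - log 2 (2 * ?d N)) / (?d N + 2)"
      by (simp add: field_simps)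
    moreover have "1 - (log 2 (2 * ?d N) / r) * (1 / r) = (r * r - log 2 (2 * ?d N)) / (r * r)"
      using r by (simp add: field_simps)
    moreover have "?d N / r + 2 * (1 / r) = (?d N + 2) / r" by (simp add: add_divide_distrib)
    ultimately show ?case using r unfolding r_def[symmetric] by (simp add: divide_simps)
  qed
  ultimately show ?thesis by (simp add: tendsto_cong)
qed

lemma real_base_at_top: "filterlim real_base at_top sequentially"
proof -
  have "filterlim (\<lambda>N. log 2 (real_base N) / sqrt_log N * sqrt_log N) at_top sequentially"
    by (rule filterlim_tendsto_pos_mult_at_top[OF log_real_base_asymp _ sqrt_log_at_top])
      (use dim_const_pos in simp)
  then have "filterlim (\<lambda>N. log 2 (real_base N)) at_top sequentially"
    by (rule filterlim_mono_eventually[OF _ order_refl order_refl])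
      (use eventually_parameters_pos in eventually_elim, simp)
  then have "filterlim (\<lambda>N. 2 powr log 2 (real_base N)) at_top sequentially"
    by (rule filterlim_compose[rotated]) real_asymp
  then show ?thesis
    by (rule filterlim_mono_eventually[OF _ order_refl order_refl])
      (use eventually_parameters_pos in eventually_elim, simp add: real_base_def)
qed

text \<open>Rounding loses less than 2 from a base that tends to infinity. The ratio enters the
  count with power \<open>d\<close>, so a limit of 1 makes its logarithmic cost
  \<open>o(d)\<close>.\<close>

lemma base_ratio_tendsto: "(\<lambda>N. real (2 * half_base N) / real_base N) \<longlonglongrightarrow> 1"
proof (rule tendsto_sandwich)
  have ev: "eventually (\<lambda>N. real_base N > 0) sequentially"
    using eventually_compose_filterlim[OF eventually_gt_at_top real_base_at_top] .
  show "eventually (\<lambda>N. 1 - 2 / real_base N \<le> real (2 * half_base N) / real_base N) sequentially"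
    using ev
  proof eventually_elim
    case (elim N)
    have "real_base N - 2 \<le> real (2 * half_base N)" unfolding half_base_eq by linarith
    then have "(real_base N - 2) / real_base N \<le> real (2 * half_base N) / real_base N"
      using elim by (intro divide_right_mono) auto
    then show ?case using elim by (simp add: diff_divide_distrib)
  qed
  show "eventually (\<lambda>N. real (2 * half_base N) / real_base N \<le> 1) sequentially"
    using ev
  proof eventually_elim
    case (elim N)
    have "real (2 * half_base N) \<le> real_base N" using elim unfolding half_base_eq by linarith
    then show ?case using elim by (simp add: field_simps)
  qed
  have "((\<lambda>x :: real. 1 - 2 / x) \<longlongrightarrow> 1) at_top" by real_asymp
  then show "(\<lambda>N. 1 - 2 / real_base N) \<longlonglongrightarrow> 1"
    using real_base_at_top by (rule filterlim_compose)
qed simp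

section \<open>The density exponent of the explicit set\<close>

text \<open>\<open>G\<close> is the binary logarithm of \<open>N ^ 2 / M\<close>, where
  \<open>M\<close> is the main term of the count, with \<open>log 2 N\<close> eliminated through
  \<open>log_real_base\<close>. The factor 2 on either side of \<open>M\<close> accounts for the
  error 1.\<close>

lemma log_card_explicit_set:
  assumes N: "N > 0" and d: "num_digits N > 0" and Q: "real_base N \<ge> 2"
  defines "G \<equiv> real (num_digits N) * log 2 (4 / 3) + log 2 (2 * real (num_digits N))
      + 2 * log 2 (real_base N) - real (num_digits N) * log 2 (real (2 * half_base N) / real_base N)"
  shows "card (explicit_set N) > 0"
    and "\<bar>2 * log 2 (real N) - log 2 (real (card (explicit_set N))) - G\<bar> \<le> 1"
proof -
  define D where "D = num_digits N"
  define p where "p = half_base N"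
  define q where "q = real (2 * p)"
  have p: "p > 0" using Q unfolding p_def half_base_eq by linarith
  then have q: "q > 0" by (simp add: q_def)
  \<comment> \<open>Rounding downwards is essential here: it gives the size hypothesis of the
    counting bounds.\<close>
  have qQ: "q \<le> real_base N" using Q unfolding q_def p_def half_base_eq by linarith
  have "q ^ (D + 2) \<le> real_base N ^ (D + 2)" using q qQ by (intro power_mono) auto
  also have "\<dots> = real N / (2 * real D)"
    using N d unfolding real_base_def D_def by (subst powr_power) (auto simp: add.commute)
  finally have "q ^ (D + 2) * (2 * real D) \<le> real N"
    using d by (simp add: pos_le_divide_eq D_def)
  then have "real (2 * D * (2 * p) ^ (D + 2)) \<le> real N"
    by (simp only: q_def of_nat_mult of_nat_power of_nat_numeral mult.commute)
  then have le: "2 * D * (2 * p) ^ (D + 2) \<le> N" by (simp only: of_nat_le_iff)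
  define K where "K = real (card (explicit_set N))"
  define M where "M = (3 / 4) ^ D * q ^ D * real N"
  have M: "M > 0" using q N by (simp add: M_def)
  have K: "M / 2 \<le> K" "K \<le> 2 * M"
    using card_digit_corner_set_bounds[OF p _ le] d
    unfolding K_def M_def explicit_set_def q_def D_def p_def by simp_all
  then have K0: "K > 0" using M by linarith
  then show "card (explicit_set N) > 0" by (simp add: K_def)
  have "log 2 (M / 2) \<le> log 2 K" "log 2 K \<le> log 2 (2 * M)"
    using K M K0 by simp_all
  then have logK: "\<bar>log 2 K - log 2 M\<bar> \<le> 1"
    using M by (simp add: log_divide log_mult)
  have "log 2 (3 / 4 :: real) = - log 2 (4 / 3)"
    by (simp add: log_divide)
  then have "log 2 M = - real D * log 2 (4 / 3) + real D * log 2 q + log 2 (real N)"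
    unfolding M_def using q N by (simp add: log_mult log_nat_power)
  moreover have "log 2 q = log 2 (q / real_base N) + log 2 (real_base N)"
    using q Q by (simp add: log_divide)
  moreover have "(real D + 2) * log 2 (real_base N) = log 2 (real N) - log 2 (2 * real D)"
    using log_real_base[OF N d] by (simp add: D_def)
  ultimately have "2 * log 2 (real N) - log 2 M = G"
    unfolding G_def D_def q_def p_def by (simp add: algebra_simps)
  then show "\<bar>2 * log 2 (real N) - log 2 (real (card (explicit_set N))) - G\<bar> \<le> 1"
    using logK by (simp add: K_def)
qed

text \<open>Divided by \<open>sqrt_log N\<close>, the window cost in \<open>G\<close> tends to
  \<open>dim_const * log 2 (4 / 3)\<close>, the squared base contributes
  \<open>2 / dim_const\<close>, and the other terms vanish; \<open>dim_const_root\<close> evaluates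
  the total.\<close>

lemma explicit_set_density_asymp:
  "(\<lambda>N. 2 * log 2 (real N) - log 2 (real (card (explicit_set N))) - 2 * sqrt (log 2 (exp 1)) * sqrt_log N)
    \<in> o(sqrt_log)"
proof -
  let ?r = sqrt_log and ?d = "\<lambda>N. real (num_digits N)"
  let ?T = "\<lambda>N. 2 * log 2 (real N) - log 2 (real (card (explicit_set N)))"
  let ?\<eta> = "\<lambda>N. log 2 (real (2 * half_base N) / real_base N)"
  define G where "G N = ?d N * log 2 (4 / 3) + log 2 (2 * ?d N) + 2 * log 2 (real_base N) - ?d N * ?\<eta> N" for N
  have "?\<eta> \<longlonglongrightarrow> log 2 1"
    by (intro tendsto_log base_ratio_tendsto tendsto_const) auto
  then have \<eta>: "?\<eta> \<longlonglongrightarrow> 0" by simp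
  have "(\<lambda>N. ?d N / ?r N * log 2 (4 / 3) + log 2 (2 * ?d N) / ?r N + 2 * (log 2 (real_base N) / ?r N)
      - ?d N / ?r N * ?\<eta> N) \<longlonglongrightarrow> dim_const * log 2 (4 / 3) + 0 + 2 * (1 / dim_const) - dim_const * 0"
    by (intro tendsto_intros num_digits_asymp log_num_digits_asymp log_real_base_asymp \<eta>)
  moreover have "(\<lambda>N. ?d N / ?r N * log 2 (4 / 3) + log 2 (2 * ?d N) / ?r N + 2 * (log 2 (real_base N) / ?r N)
      - ?d N / ?r N * ?\<eta> N) = (\<lambda>N. G N / ?r N)"
    by (simp add: G_def add_divide_distrib diff_divide_distrib)
  ultimately have G: "(\<lambda>N. G N / ?r N) \<longlonglongrightarrow> 2 * sqrt (log 2 (exp 1))"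
    using dim_const_root by simp
  have ev: "eventually (\<lambda>N. N > 0 \<and> num_digits N > 0 \<and> ?r N > 0 \<and> real_base N \<ge> 2) sequentially"
    using eventually_parameters_pos eventually_compose_filterlim[OF eventually_ge_at_top real_base_at_top, of 2]
    by eventually_elim simp
  have "(\<lambda>N. (?T N - G N) / ?r N) \<longlonglongrightarrow> 0"
  proof (rule tendsto_0_le[OF inverse_sqrt_log_tendsto])
    show "eventually (\<lambda>N. norm ((?T N - G N) / ?r N) \<le> norm (1 / ?r N) * 1) sequentially"
      using ev
    proof eventually_elim
      case (elim N)
      then show ?case
        using log_card_explicit_set(2)[of N] unfolding G_def
        by (simp add: divide_right_mono)
    qed
  qed
  from tendsto_diff[OF tendsto_add[OF this G] tendsto_const[of "2 * sqrt (log 2 (exp 1))"]]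
  have "(\<lambda>N. (?T N - G N) / ?r N + G N / ?r N - 2 * sqrt (log 2 (exp 1))) \<longlonglongrightarrow> 0" by simp
  moreover have "eventually (\<lambda>N. (?T N - G N) / ?r N + G N / ?r N - 2 * sqrt (log 2 (exp 1))
    = (?T N - 2 * sqrt (log 2 (exp 1)) * ?r N) / ?r N) sequentially"
    using ev
  proof eventually_elim
    case (elim N)
    then have "?r N \<noteq> 0" by linarith
    then show ?case by (simp only: diff_divide_distrib nonzero_mult_div_cancel_right not_False_eq_True)
  qed
  ultimately have "(\<lambda>N. (?T N - 2 * sqrt (log 2 (exp 1)) * ?r N) / ?r N) \<longlonglongrightarrow> 0"
    by (rule Lim_transform_eventually)
  then show ?thesis
    by (intro smalloI_tendsto) (use ev in \<open>auto elim!: eventually_mono\<close>)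
qed

section \<open>From the explicit set to the corner density\<close>

lemma corner_density_ge:
  assumes "A \<subseteq> grid N" "corner_free A"
  shows "real (card A) / real N ^ 2 \<le> corner_density N"
  unfolding corner_density_def
proof (rule Max_ge)
  have "finite (grid N)" by (simp add: grid_def)
  then have "finite ((\<lambda>A. real (card A) / real N ^ 2) ` Pow (grid N))" by simp
  then show "finite {real (card A) / real N ^ 2 | A. A \<subseteq> grid N \<and> corner_free A}"
    by (rule finite_subset[rotated]) auto
qed (use assms in auto)

theorem theorem1p1:
  shows "(\<exists>\<epsilon> :: nat \<Rightarrow> real. \<epsilon> \<in> o(\<lambda>N. sqrt (log 2 (real N))) \<and>
            (\<forall>\<^sub>F N in sequentially.
               corner_density N \<ge>
                 2 powr (- 2 * sqrt (log 2 (exp 1)) * sqrt (log 2 (real N)) + \<epsilon> N)))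
       \<and> (\<forall>N. explicit_set N \<subseteq> grid N \<and> corner_free (explicit_set N))
       \<and> (\<exists>\<epsilon> :: nat \<Rightarrow> real. \<epsilon> \<in> o(\<lambda>N. sqrt (log 2 (real N))) \<and>
            (\<forall>\<^sub>F N in sequentially.
               real (card (explicit_set N)) =
                 real N ^ 2 / 2 powr (2 * sqrt (log 2 (exp 1)) * sqrt (log 2 (real N)) + \<epsilon> N)))"
proof -
  \<comment> \<open>With the error defined as the exact deviation of the exponent, the formula for
    the cardinality is an identity once the set is nonempty; the analytic content is that the error
    is small.\<close>
  define \<epsilon> where "\<epsilon> N = 2 * log 2 (real N) - log 2 (real (card (explicit_set N)))
    - 2 * sqrt (log 2 (exp 1)) * sqrt_log N" for N
  have \<epsilon>: "\<epsilon> \<in> o(\<lambda>N. sqrt (log 2 (real N)))"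
    unfolding \<epsilon>_def by (rule explicit_set_density_asymp)
  have cf: "explicit_set N \<subseteq> grid N \<and> corner_free (explicit_set N)" for N
    unfolding explicit_set_def
    using digit_corner_set_subset_grid corner_free_digit_corner_set by blast
  have card: "eventually (\<lambda>N. N > 0 \<and> real (card (explicit_set N)) =
    real N ^ 2 / 2 powr (2 * sqrt (log 2 (exp 1)) * sqrt (log 2 (real N)) + \<epsilon> N)) sequentially"
    using eventually_parameters_pos eventually_compose_filterlim[OF eventually_ge_at_top real_base_at_top, of 2]
  proof eventually_elim
    case (elim N)
    define K where "K = real (card (explicit_set N))"
    have K: "K > 0" using log_card_explicit_set(1)[of N] elim by (simp add: K_def)
    have "2 * sqrt (log 2 (exp 1)) * sqrt (log 2 (real N)) + \<epsilon> N = log 2 (real N ^ 2 / K)"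
      using K elim by (simp add: \<epsilon>_def K_def log_divide log_nat_power)
    then have "2 powr (2 * sqrt (log 2 (exp 1)) * sqrt (log 2 (real N)) + \<epsilon> N) = real N ^ 2 / K"
      using K elim by simp
    then show ?case using K elim by (simp add: K_def)
  qed
  \<comment> \<open>The density is the reciprocal of the power of 2 in the size formula, so its
    error term is \<open>- \<epsilon> N\<close>.\<close>
  have "eventually (\<lambda>N. corner_density N \<ge>
    2 powr (- 2 * sqrt (log 2 (exp 1)) * sqrt (log 2 (real N)) + - \<epsilon> N)) sequentially"
    using card
  proof eventually_elim
    case (elim N)
    let ?e = "2 * sqrt (log 2 (exp 1)) * sqrt (log 2 (real N)) + \<epsilon> N"
    have "2 powr (- 2 * sqrt (log 2 (exp 1)) * sqrt (log 2 (real N)) + - \<epsilon> N) = 2 powr (- ?e)"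
      by (rule arg_cong[where f = "\<lambda>x. 2 powr x"]) simp
    also have "\<dots> = 1 / 2 powr ?e" by (simp only: powr_minus_divide)
    also have "\<dots> = real (card (explicit_set N)) / real N ^ 2"
      using elim by simp
    also have "\<dots> \<le> corner_density N"
      using cf by (intro corner_density_ge) auto
    finally show ?case .
  qed
  moreover have "(\<lambda>N. - \<epsilon> N) \<in> o(\<lambda>N. sqrt (log 2 (real N)))" using \<epsilon> by simp
  moreover have "eventually (\<lambda>N. real (card (explicit_set N)) =
    real N ^ 2 / 2 powr (2 * sqrt (log 2 (exp 1)) * sqrt (log 2 (real N)) + \<epsilon> N)) sequentially"
    using card by eventually_elim simp
  ultimately show ?thesis
    using \<epsilon> cf
    by (intro conjI allI exI[of _ "\<lambda>N. - \<epsilon> N"] exI[of _ \<epsilon>]) (assumption | simp only: cf)+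
qed

end
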